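(* Let $k\ge 2$ be an integer and let $A$ be a Boolean square block matrix with blocks $A_{ij}$ for $1\le i,j\le k$ such that each $A_{ii}$ is a (square) zero matrix and, for all $i\neq j$, $A_{ij}+A_{ji}^T$ is a matrix of all $1$s but no two corresponding entries of $A_{ij}$ and $A_{ji}^T$ are both equal to $1$. If each row sum of $A$ is nonzero, then the limit of the matrix sequence $\{A^m(A^T)^m\}_{m=1}^{\infty}$ exists and, after a simultaneous permutation of rows and columns, it equals a matrix of one of the forms $M_1$, $M_2$, $M_3$.
   Context: Boolean matrices have entries in $\{0,1\}$, and matrix sums and products are computed with Boolean arithmetic ($1+1=1$, all other sums and products as usual). The blocks $A_{ij}$ have size $n_i\times n_j$ with $n_1,\dots,n_k\ge 1$. A matrix sequence converges if it is eventually constant, and its limit is that constant value. Below, $J$ denotes an all-ones matrix and $O$ a zero matrix of appropriate size. Each diagonal block $J^{(i)}$ either does not exist (in which case the corresponding block row and block column are deleted) or is a square all-ones matrix. The forms are \[ M_1=\begin{pmatrix} J^{(1)} & J & J\\ J & J^{(2)} & O\\ J & O & J^{(3)}\end{pmatrix}, \] \[ M_2=\begin{pmatrix} J^{(1)} & J & J & J & J & J & J\\ J & J^{(2)} & O & J & J & O & O\\ J & O & J^{(3)} & O & O & J & J\\ J & J & O & J^{(4)} & O & O & O\\ J & J & O & O & J^{(5)} & O & O\\ J & O & J & O & O & J^{(6)} & O\\ J & O & J & O & O & O & J^{(7)} \end{pmatrix}, \] \[ M_3=\begin{pmatrix} J^{(1)} & J & J & J & J & J & J\\ J & J^{(2)}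 & J & J & J & J & O\\ J & J & J^{(3)} & J & J & O & J\\ J & J & J & J^{(4)} & O & J & J\\ J & J & J & O & J^{(5)} & O & O\\ J & J & O & J & O & J^{(6)} & O\\ J & O & J & J & O & O & J^{(7)} \end{pmatrix}. \] *)

theory Defs
  imports "Jordan_Normal_Form.DL_Submatrix" "HOL-Combinatorics.Permutations"
begin

text \<open>
  Boolean matrices are matrices over \<^typ>\<open>bool\<close>, made into a semiring by Boolean arithmetic:
  0 is \<^const>\<open>False\<close>, 1 is \<^const>\<open>True\<close>, and \<open>1 + 1 = 1\<close>. The matrix operations are then
  the generic ones for matrices over a semiring.
\<close>

instantiation bool :: comm_semiring_1
begin

definition zero_bool :: bool where "zero_bool = False"
definition one_bool :: bool where "one_bool = True"
definition plus_bool :: "bool \<Rightarrow> bool \<Rightarrow> bool" where "plus_bool a b = (a \<or> b)"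
definition times_bool :: "bool \<Rightarrow> bool \<Rightarrow> bool" where "times_bool a b = (a \<and> b)"

instance
  by standard (auto simp: zero_bool_def one_bool_def plus_bool_def times_bool_def)

end

type_synonym boolean_mat = "bool mat"

definition all_ones_mat :: "nat \<Rightarrow> nat \<Rightarrow> boolean_mat" where
  "all_ones_mat nr nc = mat nr nc (\<lambda>_. 1)"

text \<open>
  A block structure is given by the list of the block sizes. Blocks and entries are indexed from 0,
  so block \<open>i\<close> occupies the indices in \<open>block_indices ns i\<close>. The size 0 is permitted here: it
  describes a block row and block column that have been deleted.
\<close>

definition block_indices :: "nat list \<Rightarrow> nat \<Rightarrow> nat set" where
  "block_indices ns i = {sum_list (take i ns) ..< sum_list (take (Suc i) ns)}"

definition block :: "nat list \<Rightarrow> 'a mat \<Rightarrow> nat \<Rightarrow> nat \<Rightarrow> 'a mat" where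
  "block ns A i j = submatrix A (block_indices ns i) (block_indices ns j)"

text \<open>
  \<open>has_block_form P M\<close>: each entry 1 of the pattern \<open>P\<close> stands for a block \<open>J\<close> and each entry 0 for
  a block \<open>O\<close>. All three patterns below have diagonal 1; the size \<open>s ! i\<close> is 0 if the diagonal block
  \<open>i\<close> does not exist.
\<close>

definition has_block_form :: "boolean_mat \<Rightarrow> boolean_mat \<Rightarrow> bool" where
  "has_block_form P M \<longleftrightarrow>
    (\<exists>s. length s = dim_row P \<and> M \<in> carrier_mat (sum_list s) (sum_list s) \<and>
      (\<forall>i < dim_row P. \<forall>j < dim_col P.
        block s M i j = (if P $$ (i, j) = 1 then all_ones_mat (s ! i) (s ! j)
                         else 0\<^sub>m (s ! i) (s ! j))))"

definition M1_pattern :: boolean_mat where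
  "M1_pattern = mat_of_rows_list 3
    [[1, 1, 1],
     [1, 1, 0],
     [1, 0, 1]]"

definition M2_pattern :: boolean_mat where
  "M2_pattern = mat_of_rows_list 7
    [[1, 1, 1, 1, 1, 1, 1],
     [1, 1, 0, 1, 1, 0, 0],
     [1, 0, 1, 0, 0, 1, 1],
     [1, 1, 0, 1, 0, 0, 0],
     [1, 1, 0, 0, 1, 0, 0],
     [1, 0, 1, 0, 0, 1, 0],
     [1, 0, 1, 0, 0, 0, 1]]"

definition M3_pattern :: boolean_mat where
  "M3_pattern = mat_of_rows_list 7
    [[1, 1, 1, 1, 1, 1, 1],
     [1, 1, 1, 1, 1, 1, 0],
     [1, 1, 1, 1, 1, 0, 1],
     [1, 1, 1, 1, 0, 1, 1],
     [1, 1, 1, 0, 1, 0, 0],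
     [1, 1, 0, 1, 0, 1, 0],
     [1, 0, 1, 1, 0, 0, 1]]"

definition permute_rows_cols :: "(nat \<Rightarrow> nat) \<Rightarrow> 'a mat \<Rightarrow> 'a mat" where
  "permute_rows_cols p M = mat (dim_row M) (dim_col M) (\<lambda>(i, j). M $$ (p i, p j))"

definition mat_seq_limit :: "(nat \<Rightarrow> 'a mat) \<Rightarrow> 'a mat \<Rightarrow> bool" where
  "mat_seq_limit X L \<longleftrightarrow> (\<exists>N. \<forall>m \<ge> N. X m = L)"

end

theory Submission
  imports Defs
begin

text \<open>
  Read \<open>A\<close> as the arcs of a digraph whose vertices are the row indices and whose parts are the blocks.
  Two vertices in different parts are joined by an arc, no arc stays inside a part, and no vertex is
  a sink. The entry \<open>(u, v)\<close> of \<open>A\<^sup>m (A\<^sup>T)\<^sup>m\<close> says that \<open>u\<close> and \<open>v\<close> have a common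
  target of walks of length \<open>m\<close>. As there are no sinks, such walks can be prolonged, so the entries
  can only grow with \<open>m\<close>, and the limit exists.

  To describe the limit, take a power \<open>E = A\<^sup>N\<close> with \<open>E O E = E\<close>. In the limit, \<open>u\<close> and \<open>v\<close> are
  related iff they have a common \<open>E\<close>-successor (\<open>meet_iff_common_target\<close>). The recurrent vertices are
  those that can be reached back by \<open>E\<close> from all their \<open>E\<close>-successors; \<open>E\<close> is an equivalence relation
  on them, and every vertex has a recurrent \<open>E\<close>-successor. Hence \<open>u\<close> and \<open>v\<close> are related iff they
  reach a common equivalence class. An arc between recurrent vertices leads from one class to the next
  one, and the class of either end determines that of the other. For a walk
  \<open>x\<^sub>0, x\<^sub>1, \<dots>\<close> of recurrent vertices, the classes of \<open>x\<^sub>0, \<dots>, x\<^sub>3\<close> are all of them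
  (\<open>recurrent_covered\<close>): a recurrent vertex \<open>y\<close> outside these classes cannot be joined to \<open>x\<^sub>1\<close> or
  \<open>x\<^sub>2\<close>, so it would lie in the part of both, although \<open>x\<^sub>1\<close> and \<open>x\<^sub>2\<close> are joined.

  Label \<open>u\<close> by the nonempty set of those \<open>i < 4\<close> with \<open>(u, x\<^sub>i) \<in> E\<close>. The limit matrix is the
  intersection matrix of the labels. If there are at most two classes, the labels are nonempty subsets of a
  set of two elements, whose intersection matrix is the pattern of \<open>M\<^sub>1\<close>; if there are three, the seven
  nonempty subsets of a set of three elements give \<open>M\<^sub>3\<close>. If there are four, then
  \<open>x\<^sub>0, x\<^sub>2\<close> lie in one part and \<open>x\<^sub>1, x\<^sub>3\<close> in another. A vertex outside these two parts sends
  arcs to all \<open>x\<^sub>i\<close>, so its label is full, and so is the label of every vertex that reaches it.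
  Walks from a vertex whose label is not full therefore alternate between the two parts, and as
  \<open>N\<close> is even, the label is contained in \<open>{0, 2}\<close> or in \<open>{1, 3}\<close>
  (\<open>label_same_part\<close>). The seven labels that remain give \<open>M\<^sub>2\<close>. Finally, the vertices are
  permuted so that equal labels become adjacent (\<open>permute_into_blocks\<close>).
\<close>

section \<open>Common targets of long walks in a finite digraph without sinks\<close>

text \<open>
  By the pigeonhole principle, the powers of \<open>r\<close> are periodic with some period \<open>p\<close> from some exponent
  on. An exponent beyond that point that is a multiple of \<open>p\<close> gives an idempotent power.
\<close>

lemma idempotent_relpow:
  fixes r :: "'a rel"
  assumes "finite r"
  shows "\<exists>N>0. r ^^ (N + N) = r ^^ N"
proof -
  have "range (\<lambda>m. r ^^ Suc m) \<subseteq> Pow (Domain r \<times> Range r)"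
  proof clarify
    fix m x y assume "(x, y) \<in> r ^^ Suc m"
    then show "x \<in> Domain r \<and> y \<in> Range r"
      by (meson DomainI RangeI relpow_Suc_E relpow_Suc_E2)
  qed
  moreover have "finite (Pow (Domain r \<times> Range r))"
    using assms by (simp add: finite_Domain finite_Range)
  ultimately have "finite (range (\<lambda>m. r ^^ Suc m))"
    by (rule finite_subset)
  then have "\<not> inj (\<lambda>m. r ^^ Suc m)"
    using finite_imageD infinite_UNIV_nat by blast
  then obtain a b where "a < b" and ab: "r ^^ Suc a = r ^^ Suc b"
    unfolding inj_def by (metis nat_neq_iff)
  define p where "p = b - a"
  have p: "p > 0" "Suc b = Suc a + p"
    using \<open>a < b\<close> by (auto simp: p_def)
  have step: "r ^^ (Suc a + j + p) = r ^^ (Suc a + j)" for j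
    using ab p(2) by (metis add.assoc add.commute relpow_add)
  have periodic: "r ^^ (Suc a + j + q * p) = r ^^ (Suc a + j)" for j q
  proof (induction q)
    case (Suc q)
    then show ?case
      using step[of "j + q * p"] by (simp add: algebra_simps)
  qed simp
  define N where "N = Suc a * p"
  have "N \<ge> Suc a"
    using p(1) by (cases p) (simp_all add: N_def)
  then have "r ^^ (N + Suc a * p) = r ^^ N"
    using periodic[of "N - Suc a" "Suc a"] by (simp only: le_add_diff_inverse)
  then have "r ^^ (N + N) = r ^^ N"
    by (simp only: N_def)
  moreover have "N > 0"
    using p(1) by (simp add: N_def)
  ultimately show ?thesis by blast
qed

locale sinkless_digraph =
  fixes V :: "'a set" and A :: "'a rel"
  assumes finite_V: "finite V"
    and nonempty: "V \<noteq> {}"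
    and arcs_in_V: "A \<subseteq> V \<times> V"
    and no_sink: "u \<in> V \<Longrightarrow> \<exists>v. (u, v) \<in> A"
begin

definition idem_exp :: nat where
  "idem_exp = (SOME N. N > 0 \<and> A ^^ (N + N) = A ^^ N)"

abbreviation E :: "'a rel" where
  "E \<equiv> A ^^ idem_exp"

text \<open>
  The relation of the limit matrix, see \<open>meet_iff_common_target\<close> below.
\<close>

definition meet :: "'a \<Rightarrow> 'a \<Rightarrow> bool" where
  "meet u v \<longleftrightarrow> (\<exists>w. (u, w) \<in> E \<and> (v, w) \<in> E)"

text \<open>
  These are the vertices in the terminal components of \<open>E\<close>, that is, in the terminal strong components
  of the digraph; the \<open>E\<close>-classes are their cyclicity classes.
\<close>

definition recurrent :: "'a set" where
  "recurrent = {x \<in> V. \<forall>y. (x, y) \<in> E \<longrightarrow> (y, x) \<in> E}"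

lemma idem_exp_pos: "idem_exp > 0" and idem: "A ^^ (idem_exp + idem_exp) = E"
proof -
  have "finite A"
    using arcs_in_V finite_V finite_subset by blast
  then have "\<exists>N. N > 0 \<and> A ^^ (N + N) = A ^^ N"
    using idempotent_relpow by blast
  then have "idem_exp > 0 \<and> A ^^ (idem_exp + idem_exp) = E"
    unfolding idem_exp_def by (rule someI_ex)
  then show "idem_exp > 0" "A ^^ (idem_exp + idem_exp) = E" by auto
qed

lemma E_trans: "(u, v) \<in> E \<Longrightarrow> (v, w) \<in> E \<Longrightarrow> (u, w) \<in> E"
  using idem relpow_trans[of u v idem_exp A w idem_exp] by simp

lemma E_mult:
  assumes "m > 0"
  shows "A ^^ (m * idem_exp) = E"
  using assms
proof (induction m)
  case (Suc m)
  show ?case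
  proof (cases "m = 0")
    case False
    then have "A ^^ (Suc m * idem_exp) = A ^^ (idem_exp + idem_exp)"
      using Suc by (simp add: relpow_add)
    then show ?thesis
      using idem by simp
  qed simp
qed simp

lemma walk_in_V: "(u, v) \<in> A ^^ m \<Longrightarrow> u \<in> V \<Longrightarrow> v \<in> V"
  using arcs_in_V by (cases m) auto

lemma walk_exists: "u \<in> V \<Longrightarrow> \<exists>v. (u, v) \<in> A ^^ m"
proof (induction m)
  case (Suc m)
  then show ?case
    by (meson no_sink relpow_Suc_I walk_in_V)
qed auto

lemma E_in_V: "(u, v) \<in> E \<Longrightarrow> u \<in> V \<and> v \<in> V"
  using idem_exp_pos arcs_in_V by (metis SigmaE2 gr0_conv_Suc relpow_Suc_E relpow_Suc_E2 subsetD)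

text \<open>
  A common target after \<open>m\<close> steps can be prolonged to one after a positive multiple of \<open>idem_exp\<close> steps,
  and all these powers equal \<open>E\<close>.
\<close>

lemma meetI:
  assumes "u \<in> V" "(u, w) \<in> A ^^ m" "(v, w) \<in> A ^^ m"
  shows "meet u v"
proof -
  have "m \<le> Suc m * idem_exp"
    using idem_exp_pos by (cases idem_exp) auto
  then obtain d where d: "Suc m * idem_exp = m + d"
    using le_Suc_ex by blast
  obtain z where "(w, z) \<in> A ^^ d"
    using assms walk_in_V walk_exists by blast
  then have "(u, z) \<in> A ^^ (Suc m * idem_exp)" "(v, z) \<in> A ^^ (Suc m * idem_exp)"
    using assms relpow_trans d by metis+
  then show ?thesis
    using E_mult[of "Suc m"] by (auto simp: meet_def)
qed

lemma meet_iff_common_target: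
  assumes "u \<in> V" "m \<ge> idem_exp"
  shows "(\<exists>w. (u, w) \<in> A ^^ m \<and> (v, w) \<in> A ^^ m) \<longleftrightarrow> meet u v"
proof
  assume "meet u v"
  then obtain w where w: "(u, w) \<in> E" "(v, w) \<in> E"
    by (auto simp: meet_def)
  obtain z where "(w, z) \<in> A ^^ (m - idem_exp)"
    using w(1) E_in_V walk_exists by blast
  then have "(u, z) \<in> A ^^ (idem_exp + (m - idem_exp))" "(v, z) \<in> A ^^ (idem_exp + (m - idem_exp))"
    using w relpow_trans by metis+
  then show "\<exists>w. (u, w) \<in> A ^^ m \<and> (v, w) \<in> A ^^ m"
    using assms(2) by auto
qed (use assms meetI in blast)

lemma recurrent_in_V: "x \<in> recurrent \<Longrightarrow> x \<in> V"
  by (simp add: recurrent_def)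

lemma E_sym: "x \<in> recurrent \<Longrightarrow> (x, y) \<in> E \<Longrightarrow> (y, x) \<in> E"
  by (simp add: recurrent_def)

lemma E_refl: "x \<in> recurrent \<Longrightarrow> (x, x) \<in> E"
  using walk_exists E_sym E_trans recurrent_in_V by meson

lemma E_if_meets:
  assumes "x \<in> recurrent" "u \<in> V" "(u, w) \<in> A ^^ m" "(x, w) \<in> A ^^ m"
  shows "(u, x) \<in> E"
proof -
  obtain z where "(u, z) \<in> E" "(x, z) \<in> E"
    using meetI[of u w m x] assms by (auto simp: meet_def)
  then show ?thesis
    using E_sym[OF assms(1)] E_trans by blast
qed

text \<open>
  Equivalent vertices have equivalent successors: a walk of length \<open>idem_exp\<close> from \<open>x'\<close> through \<open>y'\<close>
  can be closed up to \<open>x\<close> and continued to \<open>y\<close>, which is a walk of length \<open>2 * idem_exp\<close> from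
  \<open>y'\<close> to \<open>y\<close>.
\<close>

lemma E_successors:
  assumes x: "x \<in> recurrent" "(x, x') \<in> E" and arcs: "(x, y) \<in> A" "(x', y') \<in> A"
  shows "(y', y) \<in> E"
proof -
  obtain M where M: "idem_exp = Suc M"
    using idem_exp_pos gr0_conv_Suc by auto
  obtain z where z: "(y', z) \<in> A ^^ M"
    using arcs(2) arcs_in_V walk_exists by blast
  then have "(x', z) \<in> E"
    using arcs(2) relpow_Suc_I2 M by metis
  then have "(z, x) \<in> E"
    using x E_sym E_trans by blast
  then have "(z, y) \<in> A ^^ Suc idem_exp"
    using arcs(1) by (rule relpow_Suc_I)
  then have "(y', y) \<in> A ^^ (M + Suc idem_exp)"
    by (rule relpow_trans[OF z])
  then show ?thesis
    using idem M by simp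
qed

text \<open>
  A walk of length \<open>idem_exp\<close> from \<open>y\<close> to \<open>z\<close>, preceded by the arc from \<open>x\<close>, is prolonged to length
  \<open>2 * idem_exp\<close>. Then \<open>x\<close> can be reached back, and \<open>y\<close> is one step further.
\<close>

lemma recurrent_closed:
  assumes "x \<in> recurrent" "(x, y) \<in> A"
  shows "y \<in> recurrent"
proof -
  have "(z, y) \<in> E" if yz: "(y, z) \<in> E" for z
  proof -
    obtain M where M: "idem_exp = Suc M"
      using idem_exp_pos gr0_conv_Suc by auto
    obtain z' where z': "(z, z') \<in> A ^^ M"
      using yz E_in_V walk_exists by blast
    have "(x, z') \<in> A ^^ (Suc idem_exp + M)"
      using relpow_Suc_I2[OF assms(2) yz] z' by (rule relpow_trans)
    then have "(x, z') \<in> E"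
      using idem M by simp
    then have "(z', y) \<in> A ^^ Suc idem_exp"
      using E_sym[OF assms(1)] relpow_Suc_I assms(2) by metis
    then have "(z, y) \<in> A ^^ (M + Suc idem_exp)"
      by (rule relpow_trans[OF z'])
    then show ?thesis
      using idem M by simp
  qed
  moreover have "y \<in> V"
    using assms(2) arcs_in_V by blast
  ultimately show ?thesis
    by (simp add: recurrent_def)
qed

text \<open>
  Among the \<open>E\<close>-successors of \<open>u\<close>, one with the fewest \<open>E\<close>-successors has the property that each of
  its \<open>E\<close>-successors has the same \<open>E\<close>-successors; these are therefore recurrent.
\<close>

lemma reaches_recurrent:
  assumes "u \<in> V"
  shows "\<exists>x \<in> recurrent. (u, x) \<in> E"
proof -
  obtain y\<^sub>0 where "(u, y\<^sub>0) \<in> E"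
    using walk_exists[OF assms] by blast
  then obtain y where uy: "(u, y) \<in> E"
    and least: "\<And>z. (u, z) \<in> E \<Longrightarrow> card (E `` {y}) \<le> card (E `` {z})"
    using ex_has_least_nat[of "\<lambda>y. (u, y) \<in> E" y\<^sub>0 "\<lambda>y. card (E `` {y})"] by blast
  have fin: "finite (E `` {z})" for z
    using finite_V E_in_V by (metis Image_singleton_iff finite_subset subsetI)
  have same: "E `` {z} = E `` {y}" if "(y, z) \<in> E" for z
    using that uy E_trans by (intro card_seteq fin least) auto
  obtain x where yx: "(y, x) \<in> E"
    using uy E_in_V walk_exists by blast
  have "(z, x) \<in> E" if "(x, z) \<in> E" for z
    using same yx that E_trans by blast
  then have "x \<in> recurrent"
    using yx E_in_V by (simp add: recurrent_def)
  then show ?thesis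
    using uy yx E_trans by blast
qed

end

section \<open>The recurrent vertices of a multipartite digraph\<close>

locale sinkless_multipartite_digraph = sinkless_digraph V A
  for V :: "'a set" and A :: "'a rel" +
  fixes part :: "'a \<Rightarrow> 'b"
  assumes arc_parts: "(u, v) \<in> A \<Longrightarrow> part u \<noteq> part v"
    and arc_exists: "u \<in> V \<Longrightarrow> v \<in> V \<Longrightarrow> part u \<noteq> part v \<Longrightarrow> (u, v) \<in> A \<or> (v, u) \<in> A"

locale recurrent_walk = sinkless_multipartite_digraph V A part
  for V :: "'a set" and A :: "'a rel" and part :: "'a \<Rightarrow> 'b" +
  fixes x :: "nat \<Rightarrow> 'a"
  assumes x_recurrent: "x i \<in> recurrent"
    and x_arc: "(x i, x (Suc i)) \<in> A"
begin

lemma x_in_V: "x i \<in> V"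
  using x_recurrent recurrent_in_V by blast

text \<open>
  Along an arc the labels shift by one: prolonging the arc reaches \<open>x (Suc i)\<close> in
  \<open>Suc idem_exp\<close> steps, as does \<open>x i\<close>.
\<close>

lemma E_pred:
  assumes "(u, v) \<in> A" "(v, x (Suc i)) \<in> E"
  shows "(u, x i) \<in> E"
proof (rule E_if_meets[OF x_recurrent])
  show "(u, x (Suc i)) \<in> A ^^ Suc idem_exp"
    using assms by (rule relpow_Suc_I2)
  show "(x i, x (Suc i)) \<in> A ^^ Suc idem_exp"
    by (rule relpow_Suc_I2[OF x_arc E_refl[OF x_recurrent]])
  show "u \<in> V"
    using assms(1) arcs_in_V by blast
qed

lemma E_Suc_iff: "(x (Suc i), x (Suc j)) \<in> E \<longleftrightarrow> (x i, x j) \<in> E"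
proof
  assume "(x (Suc i), x (Suc j)) \<in> E"
  then show "(x i, x j) \<in> E"
    by (rule E_pred[OF x_arc])
next
  assume "(x i, x j) \<in> E"
  then have "(x j, x i) \<in> E"
    by (rule E_sym[OF x_recurrent])
  then show "(x (Suc i), x (Suc j)) \<in> E"
    by (rule E_successors[OF x_recurrent _ x_arc x_arc])
qed

lemma E_shift: "(x i, x (i + j)) \<in> E \<longleftrightarrow> (x 0, x j) \<in> E"
proof (induction i)
  case (Suc i)
  then show ?case
    using E_Suc_iff[of i "i + j"] by (simp only: add_Suc)
qed (simp only: add_0)

text \<open>
  An arc between \<open>y\<close> and \<open>x (Suc i)\<close> would put \<open>y\<close> into the class before or after that of
  \<open>x (Suc i)\<close>.
\<close>

lemma part_eq_between:
  assumes "y \<in> recurrent" "(y, x i) \<notin> E" "(y, x (Suc (Suc i))) \<notin> E"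
  shows "part y = part (x (Suc i))"
proof (rule ccontr)
  assume "part y \<noteq> part (x (Suc i))"
  then consider "(y, x (Suc i)) \<in> A" | "(x (Suc i), y) \<in> A"
    using arc_exists[OF recurrent_in_V[OF assms(1)] x_in_V] by blast
  then show False
  proof cases
    case 1
    then show False
      using E_pred[OF _ E_refl[OF x_recurrent]] assms(2) by blast
  next
    case 2
    then show False
      using E_successors[OF x_recurrent E_refl[OF x_recurrent] x_arc] assms(3) by blast
  qed
qed

lemma recurrent_covered:
  assumes "y \<in> recurrent"
  shows "\<exists>i < 4. (y, x i) \<in> E"
proof (rule ccontr)
  assume "\<not> ?thesis"
  then have "(y, x i) \<notin> E" if "i < 4" for i
    using that by blast
  then have "part y = part (x 1)" "part y = part (x (Suc 1))"
    using part_eq_between[OF assms, of 0] part_eq_between[OF assms, of 1] by simp_all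
  then show False
    using arc_parts[OF x_arc] by metis
qed

lemma reaches_walk:
  assumes "u \<in> V"
  shows "\<exists>i < 4. (u, x i) \<in> E"
  using reaches_recurrent[OF assms] recurrent_covered E_trans by meson

lemma meet_iff_common_label:
  assumes "u \<in> V"
  shows "meet u v \<longleftrightarrow> (\<exists>i < 4. (u, x i) \<in> E \<and> (v, x i) \<in> E)"
proof
  assume "meet u v"
  then obtain w where w: "(u, w) \<in> E" "(v, w) \<in> E"
    by (auto simp: meet_def)
  then obtain i where "i < 4" "(w, x i) \<in> E"
    using reaches_walk E_in_V by blast
  then show "\<exists>i < 4. (u, x i) \<in> E \<and> (v, x i) \<in> E"
    using w E_trans by blast
qed (auto simp: meet_def)

end

text \<open>
  If \<open>x 0\<close> is equivalent neither to \<open>x 2\<close> nor to \<open>x 3\<close>, then there are exactly four classes, visited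
  cyclically by the walk.
\<close>

locale four_periodic_walk = recurrent_walk +
  assumes x0_x2: "(x 0, x 2) \<notin> E"
    and x0_x3: "(x 0, x 3) \<notin> E"
begin

lemma x0_x1: "(x 0, x 1) \<notin> E"
proof
  assume 01: "(x 0, x 1) \<in> E"
  then have "(x 1, x 2) \<in> E"
    using E_shift[of 1 1] by (simp add: numeral_2_eq_2)
  then show False
    using 01 E_trans x0_x2 by blast
qed

text \<open>
  The vertex \<open>x 4\<close> belongs to one of the four classes, and not to that of \<open>x 1\<close>, \<open>x 2\<close> or \<open>x 3\<close>, since
  equivalences along the walk are invariant under shifts.
\<close>

lemma x0_x4: "(x 0, x 4) \<in> E"
proof -
  obtain i where i: "i < 4" "(x 4, x i) \<in> E"
    using recurrent_covered[OF x_recurrent] by blast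
  have s: "(x i, x 4) \<in> E"
    using i(2) E_sym x_recurrent by blast
  have "(x 1, x 4) \<notin> E" "(x 2, x 4) \<notin> E" "(x 3, x 4) \<notin> E"
    using E_shift[of 1 3] E_shift[of 2 2] E_shift[of 3 1] x0_x1 x0_x2 x0_x3 by simp_all
  moreover have "i = 0 \<or> i = 1 \<or> i = 2 \<or> i = 3"
    using i(1) by auto
  ultimately show ?thesis
    using s by auto
qed

definition full :: "'a \<Rightarrow> bool" where
  "full u \<longleftrightarrow> (\<forall>i < 4. (u, x i) \<in> E)"

lemma full_pred:
  assumes "(u, v) \<in> A" "full v"
  shows "full u"
  unfolding full_def
proof (intro allI impI)
  fix i :: nat assume "i < 4"
  moreover have "(v, x 4) \<in> E"
    using assms(2) E_trans[OF _ x0_x4] by (simp add: full_def)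
  moreover have "Suc i < 4 \<or> Suc i = 4"
    using \<open>i < 4\<close> by auto
  ultimately have "(v, x (Suc i)) \<in> E"
    using assms(2) by (metis full_def)
  then show "(u, x i) \<in> E"
    using assms(1) E_pred by blast
qed

lemma x_not_full: "\<not> full (x 0)"
proof
  assume "full (x 0)"
  then have "1 < (4 :: nat) \<longrightarrow> (x 0, x 1) \<in> E"
    unfolding full_def by blast
  then show False
    using x0_x1 by simp
qed

text \<open>
  The vertex \<open>y\<close> is not equivalent to the neighbours of \<open>x (i + 2)\<close> on the walk, hence not joined to
  \<open>x (i + 2)\<close>. For \<open>y = x i\<close> this shows that the parts alternate along the walk.
\<close>

lemma part_recurrent:
  assumes "y \<in> recurrent" "(y, x i) \<in> E"
  shows "part y = part (x (i + 2))"
proof -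
  have "(x i, x (i + 1)) \<notin> E" "(x i, x (i + 3)) \<notin> E"
    using x0_x1 x0_x3 by (simp_all only: E_shift not_False_eq_True)
  then have "(y, x (Suc i)) \<notin> E" "(y, x (Suc (Suc (Suc i)))) \<notin> E"
    using E_trans[OF E_sym[OF assms]] by (auto simp: eval_nat_numeral)
  then show ?thesis
    using part_eq_between[OF assms(1), of "Suc i"] by simp
qed

lemma part_x: "part (x i) = part (x (i mod 2))"
proof (induction i rule: nat_induct2)
  case (step i)
  then show ?case
    using part_recurrent[OF x_recurrent E_refl[OF x_recurrent], of i] by simp
qed simp_all

text \<open>
  A recurrent vertex lies in the part of \<open>x 0\<close> or \<open>x 1\<close>, so \<open>u\<close> is not recurrent and no arc leads
  from \<open>x i\<close> to \<open>u\<close>. All arcs between \<open>u\<close> and the walk therefore start at \<open>u\<close>.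
\<close>

lemma full_if_other_part:
  assumes "u \<in> V" "part u \<noteq> part (x 0)" "part u \<noteq> part (x 1)"
  shows "full u"
proof -
  have part_u: "part u \<noteq> part (x i)" for i
    using assms part_x[of i] by (cases "even i") (simp_all add: even_iff_mod_2_eq_zero odd_iff_mod_2_eq_one)
  have "(x i, u) \<notin> A" for i
    using recurrent_closed[OF x_recurrent] recurrent_covered part_recurrent part_u by metis
  then have "(u, x (Suc i)) \<in> A" for i
    using arc_exists[OF assms(1) x_in_V] part_u by metis
  then have "(u, x i) \<in> E" for i
    using E_pred[OF _ E_refl[OF x_recurrent]] by blast
  then show ?thesis
    by (simp add: full_def)
qed

text \<open>
  A walk from \<open>u\<close> visits only vertices whose label is not full, by \<open>full_pred\<close>, and these lie in two
  parts only, between which every arc switches.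
\<close>

lemma walk_parity:
  assumes "u \<in> V" "\<not> full u" "(u, w) \<in> A ^^ m"
  shows "\<not> full w \<and> (part w = part u \<longleftrightarrow> even m)"
  using assms(3)
proof (induction m arbitrary: w)
  case 0
  then show ?case
    using assms by simp
next
  case (Suc m)
  then obtain v where v: "(u, v) \<in> A ^^ m" "(v, w) \<in> A" by auto
  have "\<not> full v" and vm: "part v = part u \<longleftrightarrow> even m"
    using Suc.IH[OF v(1)] by auto
  then have "\<not> full w"
    using full_pred v(2) by blast
  moreover have "u \<in> V" "v \<in> V" "w \<in> V"
    using assms(1) v arcs_in_V by auto
  then have "part z = part (x 0) \<or> part z = part (x 1)" if "z \<in> {u, v, w}" for z
    using that full_if_other_part \<open>\<not> full u\<close> \<open>\<not> full v\<close> \<open>\<not> full w\<close> by blast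
  then have "part w = part u \<longleftrightarrow> part v \<noteq> part u"
    using arc_parts[OF v(2)] by (metis insertCI)
  ultimately show ?case
    using vm by simp
qed

text \<open>
  The number \<open>idem_exp\<close> is even because some walk of this length leads from \<open>x 0\<close> to itself.
\<close>

lemma label_same_part:
  assumes "u \<in> V" "\<not> full u" "(u, x i) \<in> E"
  shows "part u = part (x i)"
proof -
  have "even idem_exp"
    using walk_parity[OF x_in_V x_not_full E_refl[OF x_recurrent]] by simp
  then show ?thesis
    using walk_parity[OF assms] by simp
qed

end

section \<open>Patterns of intersecting label sets\<close>

definition realizes :: "boolean_mat \<Rightarrow> 'a set \<Rightarrow> ('a \<Rightarrow> 'a \<Rightarrow> bool) \<Rightarrow> bool" where
  "realizes P V R \<longleftrightarrow>
    (\<exists>f. (\<forall>u \<in> V. f u < dim_row P) \<and> (\<forall>u \<in> V. \<forall>v \<in> V. P $$ (f u, f v) \<longleftrightarrow> R u v))"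

lemma pattern_dims [simp]:
  "dim_row M1_pattern = 3" "dim_col M1_pattern = 3"
  "dim_row M2_pattern = 7" "dim_col M2_pattern = 7"
  "dim_row M3_pattern = 7" "dim_col M3_pattern = 7"
  by (simp_all add: M1_pattern_def M2_pattern_def M3_pattern_def mat_of_rows_list_def)

text \<open>
  Here and in the next two lemmas, Booleans tell which elements occur in the label of a vertex, and \<open>f\<close>
  assigns to each possible label the block of the pattern that stands for it. A pattern may have more
  blocks than there are labels that occur.
\<close>

lemma realizes_M1:
  assumes "\<And>u. u \<in> V \<Longrightarrow> a u \<or> b u"
    and "\<And>u v. u \<in> V \<Longrightarrow> v \<in> V \<Longrightarrow> R u v \<longleftrightarrow> a u \<and> a v \<or> b u \<and> b v"
  shows "realizes M1_pattern V R"
proof -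
  define f :: "bool \<Rightarrow> bool \<Rightarrow> nat" where
    "f a b = (if a then if b then 0 else 1 else 2)" for a b
  have "f a b < 3" for a b
    by (simp add: f_def)
  moreover have "M1_pattern $$ (f a b, f a' b') \<longleftrightarrow> a \<and> a' \<or> b \<and> b'"
    if "a \<or> b" "a' \<or> b'" for a b a' b'
    using that
    by (cases a; cases b; cases a'; cases b')
      (simp_all add: M1_pattern_def mat_of_rows_list_def f_def one_bool_def zero_bool_def)
  ultimately show ?thesis
    unfolding realizes_def using assms
    by (intro exI[of _ "\<lambda>u. f (a u) (b u)"]) simp
qed

lemma realizes_M3:
  assumes "\<And>u. u \<in> V \<Longrightarrow> a u \<or> b u \<or> c u"
    and "\<And>u v. u \<in> V \<Longrightarrow> v \<in> V \<Longrightarrow> R u v \<longleftrightarrow> a u \<and> a v \<or> b u \<and> b v \<or> c u \<and> c v"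
  shows "realizes M3_pattern V R"
proof -
  define f :: "bool \<Rightarrow> bool \<Rightarrow> bool \<Rightarrow> nat" where
    "f a b c = (if a then if b then if c then 0 else 1 else if c then 2 else 4
                else if b then if c then 3 else 5 else 6)" for a b c
  have "f a b c < 7" for a b c
    by (simp add: f_def)
  moreover have "M3_pattern $$ (f a b c, f a' b' c') \<longleftrightarrow> a \<and> a' \<or> b \<and> b' \<or> c \<and> c'"
    if "a \<or> b \<or> c" "a' \<or> b' \<or> c'" for a b c a' b' c'
    using that
    by (cases a; cases b; cases c; cases a'; cases b'; cases c')
      (simp_all add: M3_pattern_def mat_of_rows_list_def f_def one_bool_def zero_bool_def)
  ultimately show ?thesis
    unfolding realizes_def using assms
    by (intro exI[of _ "\<lambda>u. f (a u) (b u) (c u)"]) simp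
qed

text \<open>
  The predicates \<open>a\<close>, \<open>c\<close> stand for the two classes in one part, and \<open>b\<close>, \<open>d\<close> for those in the other
  one. The blocks are numbered by the labels \<open>{a, b, c, d}\<close>, \<open>{a, c}\<close>, \<open>{b, d}\<close>, \<open>{a}\<close>,
  \<open>{c}\<close>, \<open>{b}\<close>, \<open>{d}\<close>.
\<close>

lemma realizes_M2:
  assumes "\<And>u. u \<in> V \<Longrightarrow> a u \<or> b u \<or> c u \<or> d u"
    and "\<And>u. u \<in> V \<Longrightarrow>
      a u \<and> b u \<and> c u \<and> d u \<or> \<not> b u \<and> \<not> d u \<or> \<not> a u \<and> \<not> c u"
    and "\<And>u v. u \<in> V \<Longrightarrow> v \<in> V \<Longrightarrow>
      R u v \<longleftrightarrow> a u \<and> a v \<or> b u \<and> b v \<or> c u \<and> c v \<or> d u \<and> d v"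
  shows "realizes M2_pattern V R"
proof -
  define f :: "bool \<Rightarrow> bool \<Rightarrow> bool \<Rightarrow> bool \<Rightarrow> nat" where
    "f a b c d = (if a \<and> b then 0 else if a then if c then 1 else 3 else if c then 4
                  else if b then if d then 2 else 5 else 6)" for a b c d
  have "f a b c d < 7" for a b c d
    by (simp add: f_def)
  moreover have
    "M2_pattern $$ (f a b c d, f a' b' c' d') \<longleftrightarrow> a \<and> a' \<or> b \<and> b' \<or> c \<and> c' \<or> d \<and> d'"
    if "a \<or> b \<or> c \<or> d" "a \<and> b \<and> c \<and> d \<or> \<not> b \<and> \<not> d \<or> \<not> a \<and> \<not> c"
      "a' \<or> b' \<or> c' \<or> d'" "a' \<and> b' \<and> c' \<and> d' \<or> \<not> b' \<and> \<not> d' \<or> \<not> a' \<and> \<not> c'"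
    for a b c d a' b' c' d'
    using that
    by (cases a; cases b; cases c; cases d; cases a'; cases b'; cases c'; cases d')
      (simp_all add: M2_pattern_def mat_of_rows_list_def f_def one_bool_def zero_bool_def)
  ultimately show ?thesis
    unfolding realizes_def using assms
    by (intro exI[of _ "\<lambda>u. f (a u) (b u) (c u) (d u)"]) simp
qed

lemma ex_less_4: "(\<exists>i < 4. P i) \<longleftrightarrow> P 0 \<or> P 1 \<or> P 2 \<or> P (3 :: nat)"
  by (auto simp: numeral_eq_Suc less_Suc_eq)

lemma (in sinkless_multipartite_digraph) recurrent_walk_exists:
  "\<exists>x. recurrent_walk V A part x"
proof -
  have "\<exists>x. x \<in> recurrent"
    using nonempty reaches_recurrent by blast
  moreover have "\<exists>y. y \<in> recurrent \<and> (x, y) \<in> A" if "x \<in> recurrent" for x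
    using that no_sink recurrent_in_V recurrent_closed by meson
  ultimately have "\<exists>x. \<forall>i. x i \<in> recurrent \<and> (x i, x (Suc i)) \<in> A"
    using dependent_nat_choice[of "\<lambda>_ x. x \<in> recurrent" "\<lambda>_ x y. (x, y) \<in> A"] by auto
  then show ?thesis
    using sinkless_multipartite_digraph_axioms
    by (auto simp: recurrent_walk_def recurrent_walk_axioms_def)
qed

theorem (in sinkless_multipartite_digraph) meet_classification:
  "realizes M1_pattern V meet \<or> realizes M2_pattern V meet \<or> realizes M3_pattern V meet"
proof -
  obtain x where "recurrent_walk V A part x"
    using recurrent_walk_exists by blast
  then interpret recurrent_walk V A part x .
  define l where "l i u \<longleftrightarrow> (u, x i) \<in> E" for i u
  have nonempty_label: "l 0 u \<or> l 1 u \<or> l 2 u \<or> l 3 u" if "u \<in> V" for u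
    using reaches_walk[OF that] by (simp add: l_def ex_less_4)
  have meet: "meet u v \<longleftrightarrow> l 0 u \<and> l 0 v \<or> l 1 u \<and> l 1 v \<or> l 2 u \<and> l 2 v \<or> l 3 u \<and> l 3 v"
    if "u \<in> V" for u v
    using meet_iff_common_label[OF that] by (simp add: l_def ex_less_4)
  have same: "l i u \<longleftrightarrow> l j u" if "(x i, x j) \<in> E" for i j u
    unfolding l_def using that E_sym[OF x_recurrent that] E_trans by blast
  \<comment> \<open>Equivalent vertices of the walk can be identified in the labels. The case of one class is part of the first case.\<close>
  consider (two) "(x 0, x 2) \<in> E" | (three) "(x 0, x 3) \<in> E"
    | (four) "(x 0, x 2) \<notin> E" "(x 0, x 3) \<notin> E" by blast
  then show ?thesis
  proof cases
    case two
    then have "(x 1, x 3) \<in> E"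
      using E_Suc_iff[of 0 2] by (simp add: eval_nat_numeral)
    then have "l 2 u \<longleftrightarrow> l 0 u" "l 3 u \<longleftrightarrow> l 1 u" for u
      using same two by blast+
    then have "realizes M1_pattern V meet"
      using nonempty_label meet by (intro realizes_M1[of V "l 0" "l 1"]) blast+
    then show ?thesis by blast
  next
    case three
    then have "l 3 u \<longleftrightarrow> l 0 u" for u
      using same by blast
    then have "realizes M3_pattern V meet"
      using nonempty_label meet by (intro realizes_M3[of V "l 0" "l 1" "l 2"]) blast+
    then show ?thesis by blast
  next
    case four
    then interpret four_periodic_walk V A part x
      by unfold_locales
    have "l 0 u \<and> l 1 u \<and> l 2 u \<and> l 3 u \<or> \<not> l 1 u \<and> \<not> l 3 u \<or> \<not> l 0 u \<and> \<not> l 2 u"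
      if "u \<in> V" for u
    proof (cases "full u")
      case True
      then show ?thesis
        by (simp add: full_def l_def)
    next
      case False
      have "part (x 0) \<noteq> part (x 1)" "part (x 2) = part (x 0)" "part (x 3) = part (x 1)"
        using arc_parts[OF x_arc, of 0] part_x[of 2] part_x[of 3] by simp_all
      then show ?thesis
        using label_same_part[OF that False] unfolding l_def by metis
    qed
    then have "realizes M2_pattern V meet"
      using nonempty_label meet by (intro realizes_M2[of V "l 0" "l 1" "l 2" "l 3"]) blast+
    then show ?thesis by blast
  qed
qed

section \<open>Block decompositions\<close>

text \<open>
  This is meaningful only for \<open>r < sum_list s\<close>. Taking the least \<open>i\<close> skips the blocks of size 0.
\<close>

definition block_of :: "nat list \<Rightarrow> nat \<Rightarrow> nat" where
  "block_of s r = (LEAST i. r < sum_list (take (Suc i) s))"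

lemma prefix_sum_mono: "i \<le> j \<Longrightarrow> sum_list (take i s) \<le> sum_list (take j (s :: nat list))"
  by (metis le_add1 le_add_diff_inverse sum_list.append take_add)

lemma prefix_sum_Suc:
  "i < length s \<Longrightarrow> sum_list (take (Suc i) s) = sum_list (take i s) + (s ! i :: nat)"
  by (simp add: take_Suc_conv_app_nth)

lemma block_indices_subset: "block_indices s i \<subseteq> {..<sum_list s}"
proof -
  have "sum_list (take (Suc i) s) \<le> sum_list s"
    using prefix_sum_mono[of "Suc i" "max (Suc i) (length s)" s] by simp
  then show ?thesis
    by (auto simp: block_indices_def)
qed

lemma card_block_indices: "i < length s \<Longrightarrow> card (block_indices s i) = s ! i"
  by (simp add: block_indices_def prefix_sum_Suc)

lemma block_of_eqI:
  assumes "r \<in> block_indices s i"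
  shows "block_of s r = i"
  unfolding block_of_def
proof (rule Least_equality)
  show "r < sum_list (take (Suc i) s)"
    using assms by (simp add: block_indices_def)
  fix j assume j: "r < sum_list (take (Suc j) s)"
  show "i \<le> j"
  proof (rule ccontr)
    assume "\<not> i \<le> j"
    then have "sum_list (take (Suc j) s) \<le> sum_list (take i s)"
      by (intro prefix_sum_mono) simp
    then show False
      using assms j by (simp add: block_indices_def)
  qed
qed

lemma block_of_props:
  assumes "r < sum_list s"
  shows "block_of s r < length s" "r \<in> block_indices s (block_of s r)"
proof -
  let ?P = "\<lambda>i. r < sum_list (take (Suc i) s)"
  have "length s \<noteq> 0"
    using assms by auto
  then have last: "?P (length s - 1)"
    using assms by simp
  then have "?P (block_of s r)" "block_of s r \<le> length s - 1"
    unfolding block_of_def by (rule LeastI, rule Least_le)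
  moreover have "sum_list (take (block_of s r) s) \<le> r"
  proof (cases "block_of s r")
    case (Suc i)
    then have "\<not> ?P i"
      using not_less_Least[of i ?P] unfolding block_of_def by simp
    then show ?thesis
      using Suc by simp
  qed simp
  ultimately show "r \<in> block_indices s (block_of s r)" "block_of s r < length s"
    unfolding block_indices_def using \<open>length s \<noteq> 0\<close> by (simp, linarith)
qed

lemma block_of_eq_iff:
  assumes "r < sum_list s"
  shows "block_of s r = i \<longleftrightarrow> r \<in> block_indices s i"
  using block_of_eqI block_of_props(2)[OF assms] by blast

lemma pick_interval:
  assumes "l + r < h"
  shows "pick {l..<h} r = l + r"
proof -
  have "{a \<in> {l..<h}. a < l + r} = {l..<l + r}"
    using assms by auto
  then show ?thesis
    using pick_card_in_set[of "l + r" "{l..<h}"] assms by simp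
qed

lemma block_index:
  assumes "M \<in> carrier_mat (sum_list s) (sum_list s)" "i < length s" "j < length s"
  shows "dim_row (block s M i j) = s ! i" "dim_col (block s M i j) = s ! j"
    and "r < s ! i \<Longrightarrow> c < s ! j \<Longrightarrow>
      block s M i j $$ (r, c) = M $$ (sum_list (take i s) + r, sum_list (take j s) + c)"
proof -
  have "{a. a < sum_list s \<and> a \<in> block_indices s k} = block_indices s k" for k
    using block_indices_subset by auto
  then have card: "card {a. a < sum_list s \<and> a \<in> block_indices s k} = s ! k" if "k < length s" for k
    using card_block_indices[OF that] by simp
  then show "dim_row (block s M i j) = s ! i" "dim_col (block s M i j) = s ! j"
    using assms by (simp_all add: block_def dim_submatrix)
  have pick: "pick (block_indices s k) r = sum_list (take k s) + r" if "k < length s" "r < s ! k" for k r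
    using that by (simp add: block_indices_def pick_interval prefix_sum_Suc)
  assume "r < s ! i" "c < s ! j"
  then show "block s M i j $$ (r, c) = M $$ (sum_list (take i s) + r, sum_list (take j s) + c)"
    using assms card pick by (simp add: block_def submatrix_index)
qed

lemma block_of_offset: "i < length s \<Longrightarrow> r < s ! i \<Longrightarrow> block_of s (sum_list (take i s) + r) = i"
  by (rule block_of_eqI) (simp add: block_indices_def prefix_sum_Suc)

lemma offset_less: "i < length s \<Longrightarrow> r < s ! i \<Longrightarrow> sum_list (take i s) + r < sum_list (s :: nat list)"
  using block_indices_subset[of s i] by (auto simp: block_indices_def prefix_sum_Suc subset_eq)

lemma entry_in_block:
  assumes "M \<in> carrier_mat (sum_list s) (sum_list s)" "u < sum_list s" "v < sum_list s"
  obtains r c where "r < s ! block_of s u" "c < s ! block_of s v"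
    "block s M (block_of s u) (block_of s v) $$ (r, c) = M $$ (u, v)"
    "block s M (block_of s v) (block_of s u) $$ (c, r) = M $$ (v, u)"
proof -
  let ?i = "block_of s u" and ?j = "block_of s v"
  note u = block_of_props[OF assms(2)] and v = block_of_props[OF assms(3)]
  obtain r where r: "u = sum_list (take ?i s) + r" "r < s ! ?i"
    using u(2) by (auto simp: block_indices_def prefix_sum_Suc[OF u(1)] dest!: le_Suc_ex)
  obtain c where c: "v = sum_list (take ?j s) + c" "c < s ! ?j"
    using v(2) by (auto simp: block_indices_def prefix_sum_Suc[OF v(1)] dest!: le_Suc_ex)
  show ?thesis
    using that[OF r(2) c(2)] block_index(3)[OF assms(1) u(1) v(1) r(2) c(2)]
      block_index(3)[OF assms(1) v(1) u(1) c(2) r(2)] r(1) c(1) by simp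
qed

text \<open>
  Taking the sizes of the fibres of \<open>f\<close> as block sizes, \<open>f\<close> and \<open>block_of s\<close> take each value equally
  often, so they differ by a permutation.
\<close>

lemma permute_into_blocks:
  fixes f :: "nat \<Rightarrow> nat"
  assumes "\<And>u. u < n \<Longrightarrow> f u < q"
  shows "\<exists>s p. length s = q \<and> sum_list s = n \<and> p permutes {..<n} \<and>
    (\<forall>u<n. f (p u) = block_of s u)"
proof -
  define s where "s = map (\<lambda>i. card {u \<in> {..<n}. f u = i}) [0..<q]"
  have "{..<n} = (\<Union>i<q. {u \<in> {..<n}. f u = i})"
    using assms by auto
  then have "n = card (\<Union>i<q. {u \<in> {..<n}. f u = i})"
    by (metis card_lessThan)
  also have "\<dots> = (\<Sum>i<q. card {u \<in> {..<n}. f u = i})"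
    by (subst card_UN_disjoint) auto
  also have "\<dots> = sum_list s"
    by (simp add: s_def interv_sum_list_conv_sum_set_nat atLeast0LessThan)
  finally have sum: "sum_list s = n" by simp
  have "card {u \<in> {..<n}. block_of s u = i} = card {u \<in> {..<n}. f u = i}" for i
  proof (cases "i < q")
    case True
    have "{u \<in> {..<n}. block_of s u = i} = block_indices s i"
      using block_indices_subset[of s i] sum block_of_eq_iff[of _ s i] by auto
    then show ?thesis
      using True card_block_indices[of i s] by (simp add: s_def)
  next
    case False
    have none: "block_of s u \<noteq> i" "f u \<noteq> i" if "u < n" for u
      using that False block_of_props(1)[of u s] assms[of u] sum by (auto simp: s_def)
    then have "{u \<in> {..<n}. block_of s u = i} = {}" "{u \<in> {..<n}. f u = i} = {}"
      by auto
    then show ?thesis by (simp only:)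
  qed
  moreover have "count (image_mset g (mset_set {..<n})) i = card {u \<in> {..<n}. g u = i}"
    for g :: "nat \<Rightarrow> nat" and i
  proof -
    have "count (image_mset g (mset_set {..<n})) i =
        (\<Sum>u \<in> g -` {i} \<inter> {..<n}. count (mset_set {..<n}) u)"
      by (simp add: count_image_mset)
    also have "\<dots> = card (g -` {i} \<inter> {..<n})"
      by simp
    also have "g -` {i} \<inter> {..<n} = {u \<in> {..<n}. g u = i}"
      by auto
    finally show ?thesis .
  qed
  ultimately have "image_mset (block_of s) (mset_set {..<n}) = image_mset f (mset_set {..<n})"
    by (intro multiset_eqI) (simp only:)
  then obtain p where "p permutes {..<n}" "\<forall>u \<in> {..<n}. block_of s u = f (p u)"
    by (rule image_mset_eq_implies_permutes[OF finite_lessThan])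
  then show ?thesis
    using sum by (intro exI[of _ s] exI[of _ p]) (simp add: s_def)
qed

lemma block_form_if_realizes:
  assumes "dim_col P = dim_row P" "realizes P {..<n} R"
  shows "\<exists>p. p permutes {..<n} \<and>
    has_block_form P (permute_rows_cols p (mat n n (\<lambda>(u, v). R u v)))"
proof -
  obtain f where f: "\<And>u. u < n \<Longrightarrow> f u < dim_row P"
    and R: "\<And>u v. u < n \<Longrightarrow> v < n \<Longrightarrow> R u v \<longleftrightarrow> P $$ (f u, f v)"
    using assms(2) by (auto simp: realizes_def)
  obtain s p where s: "length s = dim_row P" "sum_list s = n" and p: "p permutes {..<n}"
    and fp: "\<And>u. u < n \<Longrightarrow> f (p u) = block_of s u"
    using permute_into_blocks[of n f "dim_row P"] f by auto
  define M where "M = permute_rows_cols p (mat n n (\<lambda>(u, v). R u v))"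
  have M: "M \<in> carrier_mat (sum_list s) (sum_list s)"
    by (simp add: M_def permute_rows_cols_def s(2))
  have entry: "M $$ (u, v) = P $$ (block_of s u, block_of s v)" if "u < n" "v < n" for u v
    using that fp R permutes_in_image[OF p] by (simp add: M_def permute_rows_cols_def)
  have "block s M i j = (if P $$ (i, j) = 1 then all_ones_mat (s ! i) (s ! j)
                         else 0\<^sub>m (s ! i) (s ! j))"
    if ij: "i < length s" "j < length s" for i j
  proof (rule eq_matI)
    fix r c
    assume "r < dim_row (if P $$ (i, j) = 1 then all_ones_mat (s ! i) (s ! j)
                         else 0\<^sub>m (s ! i) (s ! j))"
      "c < dim_col (if P $$ (i, j) = 1 then all_ones_mat (s ! i) (s ! j)
                         else 0\<^sub>m (s ! i) (s ! j))"
    then have rc: "r < s ! i" "c < s ! j"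
      by (simp_all add: all_ones_mat_def split: if_splits)
    have "block s M i j $$ (r, c) = P $$ (i, j)"
      using block_index(3)[OF M ij rc] block_of_offset[OF ij(1) rc(1)] block_of_offset[OF ij(2) rc(2)]
        entry offset_less[OF ij(1) rc(1)] offset_less[OF ij(2) rc(2)] s(2) by simp
    then show "block s M i j $$ (r, c) = (if P $$ (i, j) = 1 then all_ones_mat (s ! i) (s ! j)
                         else 0\<^sub>m (s ! i) (s ! j)) $$ (r, c)"
      using rc by (simp add: all_ones_mat_def one_bool_def zero_bool_def)
  qed (use block_index(1,2)[OF M ij] in \<open>simp_all add: all_ones_mat_def\<close>)
  then have "has_block_form P M"
    unfolding has_block_form_def using s(1) M assms(1) by metis
  then show ?thesis
    using p M_def by blast
qed

section \<open>Powers of Boolean matrices count walks\<close>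

lemma sum_bool_iff: "finite S \<Longrightarrow> (\<Sum>i\<in>S. f i :: bool) \<longleftrightarrow> (\<exists>i\<in>S. f i)"
  by (induction S rule: finite_induct) (auto simp: zero_bool_def plus_bool_def)

definition arcs :: "boolean_mat \<Rightarrow> nat rel" where
  "arcs A = {(u, v). u < dim_row A \<and> v < dim_col A \<and> A $$ (u, v)}"

lemma mult_bool_mat_index:
  assumes "B \<in> carrier_mat n n" "C \<in> carrier_mat n n" "u < n" "v < n"
  shows "(B * C) $$ (u, v) \<longleftrightarrow> (\<exists>w<n. B $$ (u, w) \<and> C $$ (w, v))"
  using assms by (auto simp: scalar_prod_def sum_bool_iff times_bool_def)

lemma pow_mat_iff_walk:
  assumes "A \<in> carrier_mat n n" "u < n" "v < n"
  shows "(A ^\<^sub>m m) $$ (u, v) \<longleftrightarrow> (u, v) \<in> arcs A ^^ m"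
  using assms(3)
proof (induction m arbitrary: v)
  case 0
  then show ?case
    using assms by (simp add: one_bool_def zero_bool_def)
next
  case (Suc m)
  have "(A ^\<^sub>m Suc m) $$ (u, v) \<longleftrightarrow> (\<exists>w<n. (A ^\<^sub>m m) $$ (u, w) \<and> A $$ (w, v))"
    using mult_bool_mat_index[OF pow_carrier_mat[OF assms(1)] assms(1,2) Suc.prems] by simp
  also have "\<dots> \<longleftrightarrow> (\<exists>w. (u, w) \<in> arcs A ^^ m \<and> (w, v) \<in> arcs A)"
    using Suc assms by (auto simp: arcs_def)
  finally show ?case
    by auto
qed

lemma arcs_transpose: "arcs (A\<^sup>T) = (arcs A)\<inverse>"
  by (auto simp: arcs_def)

lemma relpow_converse:
  fixes r :: "'a rel"
  shows "(r\<inverse>) ^^ m = (r ^^ m)\<inverse>"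
proof (induction m)
  case (Suc m)
  then show ?case
    by (metis relpow.simps(2) relpow_commute converse_relcomp)
qed simp

lemma pow_times_transpose_pow_index:
  assumes "A \<in> carrier_mat n n" "u < n" "v < n"
  shows "(A ^\<^sub>m m * (A\<^sup>T) ^\<^sub>m m) $$ (u, v) \<longleftrightarrow>
    (\<exists>w<n. (u, w) \<in> arcs A ^^ m \<and> (v, w) \<in> arcs A ^^ m)"
proof -
  have T: "A\<^sup>T \<in> carrier_mat n n"
    using assms(1) by simp
  have "(w, v) \<in> arcs (A\<^sup>T) ^^ m \<longleftrightarrow> (v, w) \<in> arcs A ^^ m" for w
    by (simp add: arcs_transpose relpow_converse)
  then show ?thesis
    using mult_bool_mat_index[OF pow_carrier_mat[OF assms(1)] pow_carrier_mat[OF T] assms(2,3)]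
      pow_mat_iff_walk[OF assms(1,2)] pow_mat_iff_walk[OF T _ assms(3)] by auto
qed

section \<open>The limit of the matrix sequence\<close>

theorem corollary1p3:
  fixes k n :: nat and ns :: "nat list" and A :: "bool mat"
  assumes "k \<ge> 2"
    and "length ns = k"
    and "\<forall>i < k. ns ! i \<ge> 1"
    and "n = sum_list ns"
    and "A \<in> carrier_mat n n"
    and "\<forall>i < k. block ns A i i = 0\<^sub>m (ns ! i) (ns ! i)"
    and "\<forall>i < k. \<forall>j < k. i \<noteq> j \<longrightarrow>
           block ns A i j + (block ns A j i)\<^sup>T = all_ones_mat (ns ! i) (ns ! j)"
    and "\<forall>i < k. \<forall>j < k. i \<noteq> j \<longrightarrow>
           (\<forall>r < ns ! i. \<forall>c < ns ! j.
             \<not> (block ns A i j $$ (r, c) = 1 \<and> (block ns A j i)\<^sup>T $$ (r, c) = 1))"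
    and "\<forall>r < n. (\<Sum>c < n. A $$ (r, c)) \<noteq> 0"
  shows "\<exists>L. mat_seq_limit (\<lambda>m. A ^\<^sub>m m * (A\<^sup>T) ^\<^sub>m m) L \<and>
           (\<exists>p. p permutes {..<n} \<and>
             (has_block_form M1_pattern (permute_rows_cols p L) \<or>
              has_block_form M2_pattern (permute_rows_cols p L) \<or>
              has_block_form M3_pattern (permute_rows_cols p L)))"
proof -
  note A = assms(5)
  have A_ns: "A \<in> carrier_mat (sum_list ns) (sum_list ns)"
    using A assms(4) by simp
  have part_less: "block_of ns u < k" if "u < n" for u
    using block_of_props(1)[of u ns] that assms(2,4) by simp
  interpret sinkless_multipartite_digraph "{..<n}" "arcs A" "block_of ns"
  proof unfold_locales
    have "ns ! 0 \<le> sum_list ns"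
      using assms(1,2) by (intro elem_le_sum_list) simp
    moreover have "ns ! 0 \<ge> 1"
      using assms(1,3) by simp
    ultimately have "0 < n"
      using assms(4) by linarith
    then show "{..<n} \<noteq> {}"
      by blast
  next
    show "arcs A \<subseteq> {..<n} \<times> {..<n}"
      using A by (auto simp: arcs_def)
  next
    fix u assume "u \<in> {..<n}"
    then have "\<exists>v<n. A $$ (u, v)"
      using assms(9) by (auto simp: zero_bool_def sum_bool_iff)
    then show "\<exists>v. (u, v) \<in> arcs A"
      using A \<open>u \<in> {..<n}\<close> by (auto simp: arcs_def)
  next
    fix u v assume uv: "(u, v) \<in> arcs A"
    then have less: "u < n" "v < n"
      using A by (auto simp: arcs_def)
    show "block_of ns u \<noteq> block_of ns v"
    proof
      assume same: "block_of ns u = block_of ns v"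
      obtain r c where "r < ns ! block_of ns u" "c < ns ! block_of ns v"
        "block ns A (block_of ns u) (block_of ns v) $$ (r, c) = A $$ (u, v)"
        using entry_in_block[OF A_ns] less assms(4) by metis
      then have "\<not> A $$ (u, v)"
        using assms(6) part_less[OF less(2)] same by (simp add: zero_bool_def)
      then show False
        using uv by (simp add: arcs_def)
    qed
  next
    fix u v assume "u \<in> {..<n}" "v \<in> {..<n}" and neq: "block_of ns u \<noteq> block_of ns v"
    then have less: "u < n" "v < n" by simp_all
    let ?i = "block_of ns u" and ?j = "block_of ns v"
    obtain r c where rc: "r < ns ! ?i" "c < ns ! ?j"
      and entries: "block ns A ?i ?j $$ (r, c) = A $$ (u, v)"
        "block ns A ?j ?i $$ (c, r) = A $$ (v, u)"
      using entry_in_block[OF A_ns] less assms(4) by metis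
    have ij: "?i < length ns" "?j < length ns"
      using part_less less assms(2) by simp_all
    have "(block ns A ?i ?j + (block ns A ?j ?i)\<^sup>T) $$ (r, c)"
      using assms(7) part_less less neq rc by (simp add: all_ones_mat_def one_bool_def)
    then have "A $$ (u, v) \<or> A $$ (v, u)"
      using rc entries block_index(1,2)[OF A_ns ij(2,1)] by (simp add: plus_bool_def)
    then show "(u, v) \<in> arcs A \<or> (v, u) \<in> arcs A"
      using A less by (auto simp: arcs_def)
  qed simp
  define L where "L = mat n n (\<lambda>(u, v). meet u v)"
  have "A ^\<^sub>m m * (A\<^sup>T) ^\<^sub>m m = L" if "m \<ge> idem_exp" for m
  proof (rule eq_matI)
    fix u v assume "u < dim_row L" "v < dim_col L"
    then have less: "u < n" "v < n"
      by (simp_all add: L_def)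
    have "w < n" if "(u, w) \<in> arcs A ^^ m" for w
      using walk_in_V[OF that] less(1) by simp
    then have "(A ^\<^sub>m m * (A\<^sup>T) ^\<^sub>m m) $$ (u, v) \<longleftrightarrow>
        (\<exists>w. (u, w) \<in> arcs A ^^ m \<and> (v, w) \<in> arcs A ^^ m)"
      using pow_times_transpose_pow_index[OF A less] by blast
    then show "(A ^\<^sub>m m * (A\<^sup>T) ^\<^sub>m m) $$ (u, v) = L $$ (u, v)"
      using meet_iff_common_target[of u m v] less that by (simp add: L_def)
  qed (use A in \<open>simp_all add: L_def\<close>)
  then have "mat_seq_limit (\<lambda>m. A ^\<^sub>m m * (A\<^sup>T) ^\<^sub>m m) L"
    by (auto simp: mat_seq_limit_def)
  moreover have "\<exists>p. p permutes {..<n} \<and>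
      (has_block_form M1_pattern (permute_rows_cols p L) \<or>
       has_block_form M2_pattern (permute_rows_cols p L) \<or>
       has_block_form M3_pattern (permute_rows_cols p L))"
    using meet_classification block_form_if_realizes[of M1_pattern n meet]
      block_form_if_realizes[of M2_pattern n meet] block_form_if_realizes[of M3_pattern n meet]
    unfolding L_def by auto
  ultimately show ?thesis by blast
qed

end
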